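(* Let $G$ be a graph, let $t=t_1,t_2,\dots$ be a sequence of positive integers, and let $S$ be a $t$-sequence-subdivision of $G$ (with associated labellings $\ell,\ell'$ and proper white/black $2$-colouring of $G$). Then every discriminating vertex colouring of $S$ is anagram-free.
   Context: An anagram is a word of the form $WP$ where $W$ is a non-empty word and $P$ is a permutation of $W$. A vertex colouring of a graph is anagram-free if the sequence of colours along every path is not an anagram; a path is called an anagram if its colour sequence is. A subdivision $S$ of $G$ replaces each edge $uv$ by a path with endpoints $u,v$; vertices of $G$ are original vertices, the others division vertices. $S$ is a $t$-sequence-subdivision of $G$ if there is a bijection $\ell:V(G)\to[|V(G)|]$ and a proper $2$-colouring of $G$ with colours white and black such that: (i) $\ell(u)>\ell(v)$ for every white $u$ and black $v$; (ii) letting $w(e)$, $b(e)$ be the white and black endpoints of $e\in E(G)$, and $\ell':E(G)\to[|E(G)|]$ the bijection ordering edges lexicographically by $(\ell(w(e)),\ell(b(e)))$ (i.e. $\ell'(x)>\ell'(y)$ iff $\ell(w(x))>\ell(w(y))$, or $\ell(w(x))=\ell(w(y))$ and $\ell(b(x))>\ell(b(y))$), every edge $e$ has exactly $3t_{\ell'(e)}$ division vertices in $S$. For each $e\in E(G)$ let $X(e),Y(e),Z(e)$ be the pairwise disjoint subpaths of the path replacing $e$, each with $t_{\ell'(e)}$ vertices (all division vertices), such that $X(e)$ is adjacent to the white end of $e$ and $Z(e)$ is adjacent to the black end. A vertex colouring of $S$ is discriminating if: (1) the original vertices are coloured by the white/black $2$-colouring of $G$, and the colours white and black occur only on original vertices;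 (2) every path of $S$ that is an anagram contains at least one original vertex; (3) for each $Q\in\{X,Y,Z\}$ there is a nonempty set of colours $C(Q)$ occurring only on vertices of the paths $Q(e)$, $e\in E(G)$; (4) for each $Q\in\{X,Y,Z\}$ and $q\in E(G)$, $\sum_{e\in E(G):\ell'(e)<\ell'(q)}|V_{C(Q)}(Q(e))|<|V_{C(Q)}(Q(q))|$, where $V_C(H)$ denotes the set of vertices of $H$ with a colour in $C$. *)

theory Defs
  imports "Graph_Theory.Graph_Theory" "HOL-Combinatorics.List_Permutation"
begin

text \<open>
  Finite simple undirected graphs are the symmetric loop-free digraphs \<^locale>\<open>pair_graph\<close>: an
  edge is a pair of opposite arcs. Paths are the nonempty lists \<^const>\<open>vpath\<close> of distinct,
  consecutively adjacent vertices; a single vertex is a path.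
\<close>

definition anagram :: "'c list \<Rightarrow> bool" where
  "anagram w \<longleftrightarrow> (\<exists>W P. w = W @ P \<and> W \<noteq> [] \<and> P <~~> W)"

definition anagram_free :: "'a pair_pre_digraph \<Rightarrow> ('a \<Rightarrow> 'c) \<Rightarrow> bool" where
  "anagram_free S c \<longleftrightarrow> (\<forall>p. vpath p (with_proj S) \<longrightarrow> \<not> anagram (map c p))"


text \<open>
  \<open>R (u, v)\<close> is the vertex sequence, read from \<open>u\<close> to \<open>v\<close>, of the path replacing the edge \<open>uv\<close>.
  The relation \<^const>\<open>subdivision\<close> is not used because it does not record these paths. The
  original graph and its subdivision share a vertex type, the original vertices being literally
  vertices of the subdivision.
\<close>

definition division_verts :: "('a \<times> 'a \<Rightarrow> 'a list) \<Rightarrow> 'a \<times> 'a \<Rightarrow> 'a list" where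
  "division_verts R e = butlast (tl (R e))"

definition subdivision_via ::
  "'a pair_pre_digraph \<Rightarrow> 'a pair_pre_digraph \<Rightarrow> ('a \<times> 'a \<Rightarrow> 'a list) \<Rightarrow> bool" where
  "subdivision_via G S R \<longleftrightarrow>
     (\<forall>(u, v) \<in> parcs G. R (u, v) \<noteq> [] \<and> hd (R (u, v)) = u \<and> last (R (u, v)) = v \<and>
        distinct (R (u, v)) \<and> R (v, u) = rev (R (u, v))) \<and>
     (\<forall>e \<in> parcs G. set (division_verts R e) \<inter> pverts G = {}) \<and>
     (\<forall>(u, v) \<in> parcs G. \<forall>e \<in> parcs G. e \<noteq> (u, v) \<and> e \<noteq> (v, u) \<longrightarrow>
        set (division_verts R (u, v)) \<inter> set (division_verts R e) = {}) \<and>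
     pverts S = pverts G \<union> (\<Union>e \<in> parcs G. set (R e)) \<and>
     parcs S = (\<Union>e \<in> parcs G. set (vwalk_arcs (R e)))"


definition proper_two_colouring ::
  "'a pair_pre_digraph \<Rightarrow> 'c \<Rightarrow> 'c \<Rightarrow> ('a \<Rightarrow> 'c) \<Rightarrow> bool" where
  "proper_two_colouring G white black f \<longleftrightarrow>
     white \<noteq> black \<and> (\<forall>v \<in> pverts G. f v \<in> {white, black}) \<and>
     (\<forall>(u, v) \<in> parcs G. f u \<noteq> f v)"

text \<open>
  Given a proper 2-colouring, every edge \<open>e\<close> is represented exactly once, by its arc from the white
  endpoint \<open>w(e) = fst e\<close> to the black endpoint \<open>b(e) = snd e\<close>.
\<close>

definition wb_edges :: "'a pair_pre_digraph \<Rightarrow> 'c \<Rightarrow> 'c \<Rightarrow> ('a \<Rightarrow> 'c) \<Rightarrow> ('a \<times> 'a) set" where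
  "wb_edges G white black f = {e \<in> parcs G. f (fst e) = white \<and> f (snd e) = black}"

text \<open>
  The sequence \<open>t\<close> is indexed from 1; the value \<open>t 0\<close> is never used.
\<close>

definition sequence_subdivision ::
  "(nat \<Rightarrow> nat) \<Rightarrow> 'a pair_pre_digraph \<Rightarrow> 'c \<Rightarrow> 'c \<Rightarrow> ('a \<Rightarrow> 'c) \<Rightarrow> ('a \<Rightarrow> nat) \<Rightarrow>
   ('a \<times> 'a \<Rightarrow> nat) \<Rightarrow> 'a pair_pre_digraph \<Rightarrow> ('a \<times> 'a \<Rightarrow> 'a list) \<Rightarrow> bool" where
  "sequence_subdivision t G white black f l l' S R \<longleftrightarrow>
     subdivision_via G S R \<and>
     proper_two_colouring G white black f \<and>
     bij_betw l (pverts G) {1..card (pverts G)} \<and>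
     (\<forall>u \<in> pverts G. \<forall>v \<in> pverts G. f u = white \<and> f v = black \<longrightarrow> l u > l v) \<and>
     bij_betw l' (wb_edges G white black f) {1..card (wb_edges G white black f)} \<and>
     (\<forall>x \<in> wb_edges G white black f. \<forall>y \<in> wb_edges G white black f.
        l' x > l' y \<longleftrightarrow>
          l (fst x) > l (fst y) \<or> l (fst x) = l (fst y) \<and> l (snd x) > l (snd y)) \<and>
     (\<forall>e \<in> wb_edges G white black f. length (division_verts R e) = 3 * t (l' e))"


datatype third = X | Y | Z

fun third_path ::
  "(nat \<Rightarrow> nat) \<Rightarrow> ('a \<times> 'a \<Rightarrow> nat) \<Rightarrow> ('a \<times> 'a \<Rightarrow> 'a list) \<Rightarrow> third \<Rightarrow> 'a \<times> 'a \<Rightarrow> 'a list" where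
  "third_path t l' R X e = take (t (l' e)) (division_verts R e)"
| "third_path t l' R Y e = take (t (l' e)) (drop (t (l' e)) (division_verts R e))"
| "third_path t l' R Z e = drop (2 * t (l' e)) (division_verts R e)"

definition discriminating ::
  "(nat \<Rightarrow> nat) \<Rightarrow> 'a pair_pre_digraph \<Rightarrow> 'c \<Rightarrow> 'c \<Rightarrow> ('a \<Rightarrow> 'c) \<Rightarrow>
   ('a \<times> 'a \<Rightarrow> nat) \<Rightarrow> 'a pair_pre_digraph \<Rightarrow> ('a \<times> 'a \<Rightarrow> 'a list) \<Rightarrow> ('a \<Rightarrow> 'c) \<Rightarrow> bool" where
  "discriminating t G white black f l' S R c \<longleftrightarrow>
     (\<forall>v \<in> pverts G. c v = f v) \<and>
     (\<forall>v \<in> pverts S. c v \<in> {white, black} \<longrightarrow> v \<in> pverts G) \<and>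
     (\<forall>p. vpath p (with_proj S) \<and> anagram (map c p) \<longrightarrow> set p \<inter> pverts G \<noteq> {}) \<and>
     (\<exists>C :: third \<Rightarrow> 'c set. \<forall>Q.
        C Q \<noteq> {} \<and>
        (\<forall>v \<in> pverts S. c v \<in> C Q \<longrightarrow>
           (\<exists>e \<in> wb_edges G white black f. v \<in> set (third_path t l' R Q e))) \<and>
        (\<forall>q \<in> wb_edges G white black f.
           (\<Sum>e \<in> {e \<in> wb_edges G white black f. l' e < l' q}.
              card {v \<in> set (third_path t l' R Q e). c v \<in> C Q})
           < card {v \<in> set (third_path t l' R Q q). c v \<in> C Q}))"

end

(* Suppose the two halves A and B of a path have equal colour multisets. Original vertices
   alternate between white and black along the path, so by parity each half contains the same even,
   positive number of them; after reversal if necessary, both halves meet white first and black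
   last. Hence the path consists of fully traversed edges, one edge k that contains the cut, a
   partial edge e0 entered through X at the front and a partial edge e2 entered through Z at the
   back. By the growth condition, whenever Q(q) lies completely in one half, an edge larger than q
   meets the path in its Q part. Take q largest among all edges having some third completely in one
   half. The larger edge has no complete third, so it is e0 with Q = X or e2 with Q = Z. This
   excludes that Y(q) is complete, and q = e0 or q = e2 would have to be larger than itself. If
   q = k, then X(k) is complete since the cut spares X or Y, so e0 > k; but the white ends of e0
   and k also lie on fully traversed edges, which are at most k, and the lexicographic order then
   forces these white ends to coincide. *)

theory Submission
  imports Defs "HOL-Library.Sublist"
begin

section \<open>Lists\<close>

lemma in_vwalk_arcs_iff:
  "(x, y) \<in> set (vwalk_arcs p) \<longleftrightarrow> (\<exists>xs ys. p = xs @ x # y # ys)"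
proof (induction p rule: vwalk_arcs.induct)
  case (3 a b p)
  show ?case
  proof
    assume "(x, y) \<in> set (vwalk_arcs (a # b # p))"
    then consider "x = a" "y = b" | "(x, y) \<in> set (vwalk_arcs (b # p))"
      by auto
    then show "\<exists>xs ys. a # b # p = xs @ x # y # ys"
    proof cases
      case 1
      then show ?thesis by (metis append_Nil)
    next
      case 2
      then show ?thesis using "3.IH" by (metis append_Cons)
    qed
  next
    assume "\<exists>xs ys. a # b # p = xs @ x # y # ys"
    then obtain xs ys where "a # b # p = xs @ x # y # ys" by blast
    then show "(x, y) \<in> set (vwalk_arcs (a # b # p))"
      using "3.IH" by (cases xs) auto
  qed
qed auto

lemma successively_iff_vwalk_arcs:
  "successively (\<lambda>x y. (x, y) \<in> A) p \<longleftrightarrow> set (vwalk_arcs p) \<subseteq> A"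
  by (induction p rule: vwalk_arcs.induct) auto

text \<open>The first letter fills every second position, so it makes up half of the word, rounded
  up. The length is odd exactly when the last letter equals the first, whence the
  \<open>of_bool\<close>.\<close>

lemma alternating_length:
  assumes "successively (\<noteq>) xs" and "xs \<noteq> []"
  shows "(length xs :: nat) + of_bool (last xs = hd xs) = 2 * count (mset xs) (hd xs :: bool)"
  using assms
proof (induction xs)
  case (Cons a xs)
  show ?case
  proof (cases "xs = []")
    case False
    have "count (mset xs) a + count (mset xs) (\<not> a) = length xs"
      by (induction xs) auto
    moreover have "hd xs = (\<not> a)"
      using Cons.prems False by (auto simp: successively_Cons)
    moreover have "length xs + of_bool (last xs = hd xs) = 2 * count (mset xs) (hd xs)"
      using Cons False by (auto simp: successively_Cons)
    ultimately show ?thesis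
      using False by (cases "last xs = a") auto
  qed simp
qed simp

text \<open>
  An alternating word of odd length has a majority letter, its first and its last one, so two
  such words cannot follow one another alternatingly and be anagrams.
\<close>
lemma alternating_halves:
  fixes xs ys :: "bool list"
  assumes alt: "successively (\<noteq>) (xs @ ys)" and eq: "mset xs = mset ys" and "xs \<noteq> []"
  shows "last xs \<noteq> hd xs" and "last ys \<noteq> hd ys" and "hd ys = hd xs"
proof -
  have ne: "ys \<noteq> []" using assms by auto
  have len: "length xs = length ys" using eq by (metis size_mset)
  have join: "last xs \<noteq> hd ys"
    and xs: "length xs + of_bool (last xs = hd xs) = 2 * count (mset xs) (hd xs)"
    and ys: "length ys + of_bool (last ys = hd ys) = 2 * count (mset xs) (hd ys)"
    using alt ne \<open>xs \<noteq> []\<close> alternating_length[of xs] alternating_length[of ys] eq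
    by (auto simp: successively_append_iff)
  have total: "count (mset xs) a + count (mset xs) (\<not> a) = length xs" for a
    by (induction xs) auto
  have parity: "last xs = hd xs \<longleftrightarrow> last ys = hd ys"
    using arg_cong[OF xs, of even] arg_cong[OF ys, of even] len
    by (cases "last xs = hd xs"; cases "last ys = hd ys") simp_all
  show *: "last xs \<noteq> hd xs"
  proof
    assume "last xs = hd xs"
    then have "hd ys = (\<not> hd xs)" using join by auto
    then show False
      using xs ys total[of "hd xs"] parity len \<open>last xs = hd xs\<close> by simp
  qed
  show "last ys \<noteq> hd ys" using * parity by simp
  show "hd ys = hd xs" using * join by auto
qed

text \<open>Used on each half of a path, with \<open>P\<close> singling out the original vertices:
  \<open>us\<close> and \<open>vs\<close> take the division vertices before the first and after the
  last of them.\<close>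

lemma trim_outside:
  assumes "filter P xs \<noteq> []"
  obtains us ys vs where "xs = us @ ys @ vs" "ys \<noteq> []" "hd ys = hd (filter P xs)"
    "last ys = last (filter P xs)" "\<forall>x \<in> set us. \<not> P x" "\<forall>x \<in> set vs. \<not> P x"
proof -
  have "\<exists>x \<in> set xs. P x" using assms by (auto simp: filter_empty_conv)
  then obtain us y zs where xs: "xs = us @ y # zs" "P y" "\<forall>x \<in> set us. \<not> P x"
    by (rule split_list_first_propE)
  then obtain ys z vs where yzs: "y # zs = ys @ z # vs" "P z" "\<forall>x \<in> set vs. \<not> P x"
    using split_list_last_prop[of "y # zs" P] by auto
  have *: "filter P xs = filter P (y # zs)" using xs by (simp add: filter_False)
  have "hd (filter P xs) = y" using * xs by simp
  moreover have "last (filter P xs) = z" unfolding * yzs using yzs by (simp add: filter_False)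
  moreover have "hd (ys @ [z]) = y" using yzs by (cases ys) auto
  ultimately show thesis using that[of us "ys @ [z]" vs] xs yzs by auto
qed

lemma prefix_past_append:
  "\<lbrakk>prefix r (xs @ ys); distinct (xs @ ys); x \<in> set r; x \<in> set ys\<rbrakk> \<Longrightarrow> set xs \<subseteq> set r"
  by (auto simp: prefix_append dest: set_mono_prefix)

lemma suffix_past_append:
  "\<lbrakk>suffix r (xs @ ys); distinct (xs @ ys); x \<in> set r; x \<in> set xs\<rbrakk> \<Longrightarrow> set ys \<subseteq> set r"
  by (auto simp: suffix_append dest: set_mono_suffix)

text \<open>Vertices with a colour in \<open>K\<close> are counted by the colour multiset alone, so
  the two halves of an anagram contain equally many.\<close>

lemma card_filter_eq_size_mset:
  "distinct xs \<Longrightarrow> card {v \<in> set xs. c v \<in> K} = size {#k \<in># mset (map c xs). k \<in> K#}"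
  by (simp add: mset_filter[symmetric] filter_map o_def distinct_card[symmetric] del: mset_filter
      flip: mset_map)

section \<open>Paths in a subdivision\<close>

locale subdivided_graph =
  fixes G S :: "'a pair_pre_digraph" and R :: "'a \<times> 'a \<Rightarrow> 'a list"
  assumes graph: "pair_graph G" and subdivided: "subdivision_via G S R"
begin

abbreviation D :: "'a \<times> 'a \<Rightarrow> 'a list" where "D \<equiv> division_verts R"

text \<open>Weaker than \<open>vpath\<close>: the empty list is allowed and membership in
  \<open>pverts S\<close> is not demanded, so the notion passes to every infix.\<close>

definition spath :: "'a list \<Rightarrow> bool" where
  "spath p \<longleftrightarrow> distinct p \<and> successively (\<lambda>x y. (x, y) \<in> parcs S) p"

lemma spath_if_vpath: "vpath p (with_proj S) \<Longrightarrow> spath p"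
  by (auto simp: vpath_def vwalk_def spath_def successively_iff_vwalk_arcs)

lemma spath_appendD: "spath (p @ q) \<Longrightarrow> spath p" "spath (p @ q) \<Longrightarrow> spath q"
  by (auto simp: spath_def successively_append_iff)

lemma spath_infixD: "spath (p @ q @ r) \<Longrightarrow> spath q"
  by (blast dest: spath_appendD)

lemma spath_ConsD: "spath (x # p) \<Longrightarrow> spath p"
  by (auto simp: spath_def successively_Cons)

section \<open>Edges of the graph and the paths that replace them\<close>

lemma arc_sym: "(u, v) \<in> parcs G \<Longrightarrow> (v, u) \<in> parcs G"
proof -
  interpret pair_graph G by (rule graph)
  show "(u, v) \<in> parcs G \<Longrightarrow> (v, u) \<in> parcs G" by (rule arcs_symmetric)
qed

lemma arc_verts: "(u, v) \<in> parcs G \<Longrightarrow> u \<in> pverts G" "(u, v) \<in> parcs G \<Longrightarrow> v \<in> pverts G"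
  and no_loop: "(u, v) \<in> parcs G \<Longrightarrow> u \<noteq> v"
  and finite_arcs: "finite (parcs G)"
proof -
  interpret pair_graph G by (rule graph)
  show "(u, v) \<in> parcs G \<Longrightarrow> u \<in> pverts G" "(u, v) \<in> parcs G \<Longrightarrow> v \<in> pverts G"
    by (auto dest: in_arcsD1 in_arcsD2)
  show "(u, v) \<in> parcs G \<Longrightarrow> u \<noteq> v" using pair_no_loops by fastforce
  show "finite (parcs G)" by (rule pair_finite_arcs)
qed

lemma R_eq:
  assumes "(u, v) \<in> parcs G"
  shows "R (u, v) = u # D (u, v) @ [v]"
proof -
  have *: "R (u, v) \<noteq> []" "hd (R (u, v)) = u" "last (R (u, v)) = v"
    using subdivided assms by (auto simp: subdivision_via_def)
  then obtain xs where xs: "R (u, v) = u # xs" by (cases "R (u, v)") auto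
  with * no_loop[OF assms] have "xs \<noteq> []" "last xs = v" by (auto split: if_splits)
  then show ?thesis using xs by (auto simp: division_verts_def)
qed

lemma distinct_R: "(u, v) \<in> parcs G \<Longrightarrow> distinct (R (u, v))"
  and R_rev: "(u, v) \<in> parcs G \<Longrightarrow> R (v, u) = rev (R (u, v))"
  and D_not_vert: "e \<in> parcs G \<Longrightarrow> x \<in> set (D e) \<Longrightarrow> x \<notin> pverts G"
  using subdivided unfolding subdivision_via_def by (fast elim: conjE)+

lemma parcs_S: "parcs S = (\<Union>e \<in> parcs G. set (vwalk_arcs (R e)))"
  using subdivided by (simp add: subdivision_via_def)

lemma D_disjoint:
  "\<lbrakk>(u, v) \<in> parcs G; e \<in> parcs G; x \<in> set (D (u, v)); x \<in> set (D e)\<rbrakk>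
    \<Longrightarrow> e = (u, v) \<or> e = (v, u)"
proof -
  have "\<forall>(u, v) \<in> parcs G. \<forall>e \<in> parcs G. e \<noteq> (u, v) \<and> e \<noteq> (v, u) \<longrightarrow>
      set (D (u, v)) \<inter> set (D e) = {}"
    using subdivided unfolding subdivision_via_def by (elim conjE)
  moreover assume "(u, v) \<in> parcs G" "e \<in> parcs G" "x \<in> set (D (u, v))" "x \<in> set (D e)"
  ultimately show "e = (u, v) \<or> e = (v, u)" by blast
qed

lemma D_rev: "(u, v) \<in> parcs G \<Longrightarrow> D (v, u) = rev (D (u, v))"
  using R_eq[of u v] R_eq[of v u] R_rev[of u v] arc_sym[of u v] by simp

lemma in_D: "e \<in> parcs G \<Longrightarrow> x \<in> set (R e) \<Longrightarrow> x \<notin> pverts G \<Longrightarrow> x \<in> set (D e)"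
  using R_eq arc_verts by (cases e) auto

section \<open>Paths of the subdivision running along edges\<close>

lemma arc_S_iff:
  "(x, y) \<in> parcs S \<longleftrightarrow> (\<exists>e xs ys. e \<in> parcs G \<and> R e = xs @ x # y # ys)"
  unfolding parcs_S by (auto simp: in_vwalk_arcs_iff)

lemma arc_S_sym: "(x, y) \<in> parcs S \<Longrightarrow> (y, x) \<in> parcs S"
proof -
  assume "(x, y) \<in> parcs S"
  then obtain u v xs ys where "(u, v) \<in> parcs G" "R (u, v) = xs @ x # y # ys"
    by (auto simp: arc_S_iff)
  then have "(v, u) \<in> parcs G" "R (v, u) = rev ys @ y # x # rev xs"
    using arc_sym[of u v] R_rev[of u v] by simp_all
  then show "(y, x) \<in> parcs S" unfolding arc_S_iff by (intro exI conjI)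
qed

lemma spath_rev: "spath p \<Longrightarrow> spath (rev p)"
  unfolding spath_def by (auto elim!: successively_mono dest: arc_S_sym)

text \<open>A division vertex lies on the replacing path of one edge only, so a path that has
  entered an edge must go on along it or turn back, and turning back repeats a vertex. Only
  \<open>butlast r\<close> avoids the original vertices: the far end of the edge may be
  reached.\<close>

lemma follow_edge:
  assumes "v \<in> pverts G" and "spath (v # r)" and "r \<noteq> []" and "set (butlast r) \<inter> pverts G = {}"
  shows "\<exists>u. (v, u) \<in> parcs G \<and> prefix (v # r) (R (v, u))"
  using assms(2-)
proof (induction r rule: rev_induct)
  case (snoc x r)
  show ?case
  proof (cases "r = []")
    case True
    with snoc.prems have "(v, x) \<in> parcs S" by (simp add: spath_def)
    then obtain a b xs ys where e: "(a, b) \<in> parcs G" and Re: "R (a, b) = xs @ v # x # ys"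
      by (auto simp: arc_S_iff)
    have "xs = []"
    proof (cases xs)
      case (Cons a' xs')
      then have "v \<in> set (D (a, b))" using R_eq[OF e] Re
        by (cases ys rule: rev_cases) (auto simp: in_set_conv_decomp eq_commute[of _ "D (a, b)"])
      then show ?thesis using D_not_vert[OF e] assms(1) by auto
    qed simp
    then show ?thesis using e Re R_eq[OF e] True by (auto intro!: exI[of _ b])
  next
    case False
    have notin: "set r \<inter> pverts G = {}" using snoc.prems by simp
    have "spath (v # r)" using snoc.prems(1) spath_appendD(1)[of "v # r" "[x]"] by simp
    moreover have "set (butlast r) \<inter> pverts G = {}"
      using notin by (auto dest: in_set_butlastD)
    ultimately obtain u where u: "(v, u) \<in> parcs G" "prefix (v # r) (R (v, u))"
      using snoc.IH False by blast
    then obtain zs where zs: "R (v, u) = (v # r) @ zs" by (auto simp: prefix_def)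
    obtain r' y where r: "r = r' @ [y]" using False by (cases r rule: rev_cases) auto
    have "(y, x) \<in> parcs S" using snoc.prems(1) unfolding r
      by (auto simp: spath_def successively_append_iff successively_Cons)
    then obtain e xs ys where e: "e \<in> parcs G" and Re: "R e = xs @ y # x # ys"
      by (auto simp: arc_S_iff)
    have "y \<notin> pverts G" using notin r by auto
    then have "y \<in> set (D e)" "y \<in> set (D (v, u))"
      using in_D[OF e] in_D[OF u(1)] Re zs r by auto
    then consider "e = (v, u)" | "e = (u, v)" using D_disjoint[OF u(1) e] by blast
    then show ?thesis
    proof cases
      case 1
      have "(v # r') @ y # zs = xs @ y # x # ys" using zs r Re 1 by simp
      moreover have "distinct ((v # r') @ y # zs)" using distinct_R[OF u(1)] zs r by simp
      ultimately have "zs = x # ys" by (subst (asm) append_Cons_eq_iff) auto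
      then show ?thesis using u(1) zs by (auto simp: prefix_def)
    next
      case 2
      \<comment> \<open>The arc from \<open>y\<close> to \<open>x\<close> runs against the edge, so
        \<open>x\<close> precedes \<open>y\<close> on \<open>R (v, u)\<close> and has been visited
        already.\<close>
      have "R (v, u) = rev ys @ x # y # rev xs"
        using Re 2 R_rev[OF arc_sym[OF u(1)]] by simp
      then have "(v # r') @ y # zs = (rev ys @ [x]) @ y # rev xs" using zs r by simp
      moreover have "distinct ((v # r') @ y # zs)" using distinct_R[OF u(1)] zs r by simp
      ultimately have "v # r' = rev ys @ [x]" by (subst (asm) append_Cons_eq_iff) auto
      then have "x \<in> set (v # r')" by (metis in_set_conv_decomp)
      then show ?thesis using snoc.prems(1) r by (auto simp: spath_def)
    qed
  qed
qed simp

text \<open>\<open>follow_edge\<close> keeps the stretch on a single edge; as \<open>v\<close> is no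
  division vertex, it must be the far end of that edge.\<close>

lemma between_originals:
  assumes "u \<in> pverts G" "v \<in> pverts G" and "spath (u # r @ [v])" and "set r \<inter> pverts G = {}"
  shows "(u, v) \<in> parcs G" and "D (u, v) = r"
proof -
  obtain w where w: "(u, w) \<in> parcs G" and "prefix (u # r @ [v]) (R (u, w))"
    using follow_edge[of u "r @ [v]"] assms by auto
  then obtain zs where zs: "D (u, w) @ [w] = r @ v # zs"
    using R_eq[OF w] by (auto simp: prefix_def)
  have "zs = []"
  proof (cases zs rule: rev_cases)
    case (snoc zs' z)
    then have "D (u, w) = r @ v # zs'" using zs by auto
    then have "v \<in> set (D (u, w))" by simp
    then show ?thesis using D_not_vert[OF w] assms(2) by auto
  qed
  then have "v = w" "D (u, w) = r" using zs by auto
  then show "(u, v) \<in> parcs G" and "D (u, v) = r" using w by auto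
qed

lemma leave_original:
  assumes "v \<in> pverts G" and "spath (v # r)" and "set r \<inter> pverts G = {}" and "r \<noteq> []"
  shows "\<exists>u. (v, u) \<in> parcs G \<and> prefix r (D (v, u))"
proof -
  obtain u where u: "(v, u) \<in> parcs G" "prefix (v # r) (R (v, u))"
    using follow_edge[of v r] assms by (auto dest: in_set_butlastD)
  then have "prefix r (D (v, u) @ [u])" using R_eq[OF u(1)] by auto
  moreover have "r \<noteq> D (v, u) @ [u]" using assms(3) arc_verts(2)[OF u(1)] by auto
  ultimately show ?thesis using u(1) by auto
qed

lemma originals_adjacent:
  assumes "spath p"
  shows "successively (\<lambda>u v. (u, v) \<in> parcs G) (filter (\<lambda>v. v \<in> pverts G) p)"
  using assms
proof (induction p)
  case (Cons v p)
  note IH = Cons.IH[OF spath_ConsD[OF Cons.prems]]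
  show ?case
  proof (cases "v \<in> pverts G \<and> (\<exists>u \<in> set p. u \<in> pverts G)")
    case True
    then obtain r u p' where p: "p = r @ u # p'" "u \<in> pverts G" "\<forall>x \<in> set r. x \<notin> pverts G"
      using split_list_first_prop[of p "\<lambda>u. u \<in> pverts G"] by auto
    have "spath (v # r @ [u])" using Cons.prems p spath_appendD(1)[of "v # r @ [u]" p'] by simp
    then have "(v, u) \<in> parcs G" using between_originals(1)[of v u r] True p by auto
    moreover have "hd (filter (\<lambda>v. v \<in> pverts G) p) = u" using p by (simp add: filter_False)
    ultimately show ?thesis using IH True by (simp add: successively_Cons)
  next
    case False
    then show ?thesis using IH by (auto simp: filter_empty_conv successively_Cons)
  qed
qed simp

text \<open>Peel off the stretch up to the second original vertex, which is a whole edge, and induct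
  on the rest. The ends differ because a one-vertex path contains no edge.\<close>

lemma covered_by_edges:
  assumes "spath p" and "hd p \<in> pverts G" "last p \<in> pverts G" and "hd p \<noteq> last p"
    and "x \<in> set p"
  shows "\<exists>e \<in> parcs G. x \<in> set (R e) \<and> set (R e) \<subseteq> set p"
  using assms
proof (induction "length p" arbitrary: p rule: less_induct)
  case less
  obtain v q where p: "p = v # q" using less.prems by (cases p) auto
  have "q \<noteq> []" using less.prems p by auto
  then obtain r u q' where q: "q = r @ u # q'" "u \<in> pverts G" "\<forall>x \<in> set r. x \<notin> pverts G"
    using split_list_first_prop[of q "\<lambda>u. u \<in> pverts G"] less.prems p
    by (metis last_ConsR last_in_set)
  have "spath (v # r @ [u])" using less.prems p q spath_appendD(1)[of "v # r @ [u]" q'] by simp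
  then have vu: "(v, u) \<in> parcs G" "D (v, u) = r"
    using between_originals[of v u r] less.prems p q by auto
  then have R: "set (R (v, u)) = set (v # r @ [u])" using R_eq[OF vu(1)] by simp
  show ?case
  proof (cases "x \<in> set (v # r @ [u])")
    case True
    then show ?thesis using vu(1) R p q by (intro bexI[of _ "(v, u)"]) auto
  next
    case False
    then have x: "x \<in> set q'" using less.prems p q by auto
    have sp: "spath (u # q')" using less.prems p q spath_appendD(2)[of "v # r" "u # q'"] by simp
    have "last q' \<noteq> u" using x sp by (metis distinct.simps(2) last_in_set list.set_cases spath_def list.distinct(1))
    then have "\<exists>e \<in> parcs G. x \<in> set (R e) \<and> set (R e) \<subseteq> set (u # q')"
      using less.prems p q x sp by (intro less.hyps) (auto split: if_splits)
    then show ?thesis using p q by auto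
  qed
qed

end

section \<open>Discriminating colourings\<close>

locale discriminating_subdivision = subdivided_graph G S R
  for G S :: "'a pair_pre_digraph" and R :: "'a \<times> 'a \<Rightarrow> 'a list" +
  fixes t :: "nat \<Rightarrow> nat" and white black :: 'c and f c :: "'a \<Rightarrow> 'c"
    and l :: "'a \<Rightarrow> nat" and l' :: "'a \<times> 'a \<Rightarrow> nat" and C :: "third \<Rightarrow> 'c set"
  assumes seq: "sequence_subdivision t G white black f l l' S R"
    and originals_coloured: "v \<in> pverts G \<Longrightarrow> c v = f v"
    and only_originals: "\<lbrakk>v \<in> pverts S; c v \<in> {white, black}\<rbrakk> \<Longrightarrow> v \<in> pverts G"
    and colours_within: "\<lbrakk>v \<in> pverts S; c v \<in> C Q\<rbrakk>
      \<Longrightarrow> \<exists>e \<in> wb_edges G white black f. v \<in> set (third_path t l' R Q e)"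
    and dominating: "q \<in> wb_edges G white black f \<Longrightarrow>
      (\<Sum>e \<in> {e \<in> wb_edges G white black f. l' e < l' q}.
         card {v \<in> set (third_path t l' R Q e). c v \<in> C Q})
      < card {v \<in> set (third_path t l' R Q q). c v \<in> C Q}"
begin

abbreviation E :: "('a \<times> 'a) set" where "E \<equiv> wb_edges G white black f"

abbreviation T :: "third \<Rightarrow> 'a \<times> 'a \<Rightarrow> 'a set" where "T Q e \<equiv> set (third_path t l' R Q e)"

section \<open>Edges oriented from white to black, and their thirds\<close>

lemma white_neq_black: "white \<noteq> black"
  and colour: "v \<in> pverts G \<Longrightarrow> f v = white \<or> f v = black"
  and proper: "(u, v) \<in> parcs G \<Longrightarrow> f u \<noteq> f v"
  and inj_l: "inj_on l (pverts G)" and inj_l': "inj_on l' E"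
  and l'_less_iff: "\<lbrakk>x \<in> E; y \<in> E\<rbrakk> \<Longrightarrow>
    l' y < l' x \<longleftrightarrow> l (fst y) < l (fst x) \<or> l (fst x) = l (fst y) \<and> l (snd y) < l (snd x)"
  using seq
  by (auto simp: sequence_subdivision_def proper_two_colouring_def bij_betw_def)

lemma E_arc: "e \<in> E \<Longrightarrow> e \<in> parcs G"
  by (simp add: wb_edges_def)

lemma finite_E: "finite E"
  using finite_arcs by (simp add: wb_edges_def)

lemma E_I: "\<lbrakk>(u, v) \<in> parcs G; f u = white\<rbrakk> \<Longrightarrow> (u, v) \<in> E"
  "\<lbrakk>(u, v) \<in> parcs G; f v = black\<rbrakk> \<Longrightarrow> (u, v) \<in> E"
  using proper[of u v] colour[of u] colour[of v] arc_verts[of u v] by (auto simp: wb_edges_def)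

declare third_path.simps [simp del]

lemma D_thirds: "D e = third_path t l' R X e @ third_path t l' R Y e @ third_path t l' R Z e"
  by (simp add: third_path.simps mult_2 flip: drop_drop)

lemma T_subset: "T Q e \<subseteq> set (D e)"
  by (subst D_thirds) (cases Q; auto)

lemma T_not_vert: "e \<in> E \<Longrightarrow> x \<in> T Q e \<Longrightarrow> x \<notin> pverts G"
  using D_not_vert E_arc T_subset by blast

lemma distinct_D: "e \<in> E \<Longrightarrow> distinct (D e)"
  using E_arc R_eq distinct_R by (cases e) fastforce

text \<open>A shared division vertex forces equal arcs up to reversal, and reversing an arc of
  \<open>E\<close> leads out of \<open>E\<close>, since it would start in black.\<close>

lemma E_disjoint: "\<lbrakk>e \<in> E; e' \<in> E; x \<in> set (D e); x \<in> set (D e')\<rbrakk> \<Longrightarrow> e = e'"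
  using D_disjoint[of "fst e" "snd e" e' x] E_arc[of e] E_arc[of e'] white_neq_black
  by (auto simp: wb_edges_def)

text \<open>For the partial edge at the front: read from its white end, \<open>Y\<close> and
  \<open>Z\<close> come only after all of \<open>X\<close>.\<close>

lemma prefix_covers_X:
  assumes "e \<in> E" "prefix r (D e)" "x \<in> set r" "x \<in> T Q e" "Q \<noteq> X"
  shows "T X e \<subseteq> set r"
  using prefix_past_append[of r "third_path t l' R X e"
    "third_path t l' R Y e @ third_path t l' R Z e" x] assms distinct_D[OF assms(1)]
  unfolding append_assoc D_thirds[of e, symmetric]
  by (cases Q) auto

lemma suffix_covers_Z:
  assumes "e \<in> E" "suffix r (D e)" "x \<in> set r" "x \<in> T Q e" "Q \<noteq> Z"
  shows "T Z e \<subseteq> set r"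
  using suffix_past_append[of r "third_path t l' R X e @ third_path t l' R Y e"
    "third_path t l' R Z e" x] assms distinct_D[OF assms(1)]
  unfolding append_assoc D_thirds[of e, symmetric]
  by (cases Q) auto

text \<open>Either the cut comes after all of \<open>X\<close>, or it falls before the end of
  \<open>X\<close> and hence before all of \<open>Y\<close>.\<close>

lemma cut_spares_X_or_Y:
  assumes "D e = r @ s"
  shows "T X e \<subseteq> set r \<or> T Y e \<subseteq> set s"
  using assms unfolding D_thirds[of e] by (auto simp: append_eq_append_conv2)

lemma T_nonempty: "e \<in> E \<Longrightarrow> T Q e \<noteq> {}"
  using dominating[of e Q] by auto

text \<open>Otherwise the vertices of \<open>B\<close> with a colour in \<open>C Q\<close> all lie
  in \<open>Q\<close> parts of edges below \<open>q\<close>; \<open>q\<close> itself is excluded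
  because the halves are disjoint. The growth condition makes them fewer than those in
  \<open>T Q q\<close>, which all lie in \<open>A\<close>, although both halves have equally
  many.\<close>

lemma larger_edge_opposite:
  assumes "distinct (A @ B)" "set (A @ B) \<subseteq> pverts S" "mset (map c A) = mset (map c B)"
    and "q \<in> E" "T Q q \<subseteq> set A"
  shows "\<exists>e \<in> E. l' q < l' e \<and> T Q e \<inter> set B \<noteq> {}"
proof (rule ccontr)
  assume none: "\<not> ?thesis"
  let ?K = "\<lambda>M. {v \<in> M. c v \<in> C Q}" and ?I = "{e \<in> E. l' e < l' q}"
  have "?K (set B) \<subseteq> (\<Union>e \<in> ?I. ?K (T Q e))"
  proof
    fix v assume v: "v \<in> ?K (set B)"
    then obtain e where e: "e \<in> E" "v \<in> T Q e" using colours_within assms(2) by fastforce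
    then have "e \<noteq> q" using v assms by auto
    then have "l' e \<noteq> l' q" using inj_l' e assms(4) by (auto simp: inj_on_def)
    moreover have "\<not> l' q < l' e" using none e v by blast
    ultimately show "v \<in> (\<Union>e \<in> ?I. ?K (T Q e))"
      using e v by (intro UN_I[of e]) auto
  qed
  then have "card (?K (set B)) \<le> card (\<Union>e \<in> ?I. ?K (T Q e))"
    using finite_E by (intro card_mono) auto
  also have "\<dots> \<le> (\<Sum>e \<in> ?I. card (?K (T Q e)))"
    using finite_E by (intro card_UN_le) auto
  also have "\<dots> < card (?K (T Q q))" by (rule dominating) (rule assms)
  also have "\<dots> \<le> card (?K (set A))" using assms(5) by (intro card_mono) auto
  also have "\<dots> = card (?K (set B))"
    using assms(1,3) by (simp add: card_filter_eq_size_mset del: mset_map)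
  finally show False by simp
qed

section \<open>Halves whose original vertices start with white and end with black\<close>

lemma covered_by_wb_edges:
  assumes "spath p" and "hd p \<in> pverts G" "last p \<in> pverts G" and "hd p \<noteq> last p"
    and "x \<in> set p"
  shows "\<exists>e \<in> E. x \<in> set (R e) \<and> set (R e) \<subseteq> set p"
proof -
  obtain u v where uv: "(u, v) \<in> parcs G" "x \<in> set (R (u, v))" "set (R (u, v)) \<subseteq> set p"
    using covered_by_edges[OF assms] by auto
  show ?thesis
  proof (cases "f u = white")
    case True
    then show ?thesis using uv E_I(1)[OF uv(1)] by blast
  next
    case False
    then have "f u = black" using colour[OF arc_verts(1)[OF uv(1)]] by simp
    then have "(v, u) \<in> E" by (rule E_I(2)[OF arc_sym[OF uv(1)]])
    then show ?thesis using uv R_rev[OF uv(1)] by (intro bexI[of _ "(v, u)"]) auto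
  qed
qed

lemma white_endpoint: "\<lbrakk>e \<in> E; x \<in> set (R e); x \<in> pverts G; f x = white\<rbrakk> \<Longrightarrow> fst e = x"
  using R_eq[of "fst e" "snd e"] E_arc[of e] D_not_vert[of e x] white_neq_black
  by (auto simp: wb_edges_def)

text \<open>\<open>A'\<close> and \<open>B'\<close> consist of fully traversed edges,
  \<open>s\<close> and \<open>s'\<close> lie inside the partial edges at the front and the back, and
  \<open>a @ b\<close> is the interior of the edge containing the cut.\<close>

lemma no_anagram_from_white:
  assumes A: "A = s @ A' @ a" and B: "B = b @ B' @ s'" and ne: "A' \<noteq> []" "B' \<noteq> []"
    and sp: "spath (A @ B)" and S: "set (A @ B) \<subseteq> pverts S"
    and eq: "mset (map c A) = mset (map c B)"
    and ends: "hd A' \<in> pverts G" "last A' \<in> pverts G" "hd B' \<in> pverts G" "last B' \<in> pverts G"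
    and colours: "f (hd A') = white" "f (last A') = black" "f (hd B') = white" "f (last B') = black"
    and outer: "\<forall>x \<in> set s \<union> set a \<union> set b \<union> set s'. x \<notin> pverts G"
  shows False
proof -
  have dist: "distinct (A @ B)" using sp by (simp add: spath_def)

  have "spath (last A' # (a @ b) @ [hd B'])"
  proof -
    have "A @ B = (s @ butlast A') @ (last A' # (a @ b) @ [hd B']) @ (tl B' @ s')"
      using ne A B by (cases A' rule: rev_cases; cases B') simp_all
    then show ?thesis using sp spath_infixD by metis
  qed
  then have mid: "(last A', hd B') \<in> parcs G" "D (last A', hd B') = a @ b"
    using between_originals[of "last A'" "hd B'" "a @ b"] ends outer by auto
  \<comment> \<open>The path crosses this edge from black to white, against the orientation used in
    \<open>E\<close>; so \<open>D ek\<close> is reversed, with \<open>b\<close> nearest to the white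
    end.\<close>
  define ek where "ek = (hd B', last A')"
  have ek: "ek \<in> E" "fst ek = hd B'" "D ek = rev b @ rev a"
    using E_I(1)[OF arc_sym[OF mid(1)]] mid(2) colours D_rev[OF mid(1)] by (simp_all add: ek_def)

  \<comment> \<open>If \<open>s\<close> is empty, there is no partial edge and \<open>e0\<close> is
    arbitrary, hence the guard. Read backwards from the white vertex \<open>hd A'\<close>,
    \<open>s\<close> takes up the start of \<open>D e0\<close>, the \<open>X\<close> side.\<close>
  have "\<exists>e0. s \<noteq> [] \<longrightarrow> e0 \<in> E \<and> fst e0 = hd A' \<and> prefix (rev s) (D e0)"
  proof (cases "s = []")
    case False
    have "A @ B = (s @ [hd A']) @ tl A' @ a @ B"
      using ne A by (cases A') simp_all
    then have "spath (rev (s @ [hd A']))" using sp spath_appendD(1) spath_rev by metis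
    then obtain u where u: "(hd A', u) \<in> parcs G" "prefix (rev s) (D (hd A', u))"
      using leave_original[of "hd A'" "rev s"] False ends outer by auto
    then show ?thesis using E_I(1)[OF u(1)] colours by (intro exI[of _ "(hd A', u)"]) simp
  qed simp
  then obtain e0 where e0: "s \<noteq> [] \<Longrightarrow> e0 \<in> E" "s \<noteq> [] \<Longrightarrow> fst e0 = hd A'"
    "s \<noteq> [] \<Longrightarrow> prefix (rev s) (D e0)" by blast

  \<comment> \<open>\<open>last B'\<close> is black, so \<open>s'\<close> takes up the end of
    \<open>D e2\<close>, the \<open>Z\<close> side.\<close>
  have "\<exists>e2. s' \<noteq> [] \<longrightarrow> e2 \<in> E \<and> suffix (rev s') (D e2)"
  proof (cases "s' = []")
    case False
    have "A @ B = (A @ b @ butlast B') @ (last B' # s')"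
      using ne B by (cases B' rule: rev_cases) simp_all
    then have "spath (last B' # s')" using sp spath_appendD(2) by metis
    then obtain u where u: "(last B', u) \<in> parcs G" "prefix s' (D (last B', u))"
      using leave_original[of "last B'" s'] False ends outer by auto
    then have "(u, last B') \<in> E" "suffix (rev s') (D (u, last B'))"
      using E_I(2)[OF arc_sym[OF u(1)]] colours D_rev[OF u(1)] by (simp_all add: suffix_to_prefix)
    then show ?thesis by blast
  qed simp
  then obtain e2 where e2: "s' \<noteq> [] \<Longrightarrow> e2 \<in> E" "s' \<noteq> [] \<Longrightarrow> suffix (rev s') (D e2)"
    by blast

  \<comment> \<open>The largest edge will be taken from \<open>W\<close>. \<open>F\<close> contains
    the fully traversed edges, but others may belong to it too, for instance \<open>ek\<close> if
    the cut falls between two thirds.\<close>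
  define whole where "whole Q e \<longleftrightarrow> T Q e \<subseteq> set A \<or> T Q e \<subseteq> set B" for Q e
  define F where "F = {e \<in> E. \<forall>Q. whole Q e}"
  define W where "W = {e \<in> E. \<exists>Q. whole Q e}"
  have "F \<subseteq> W" by (auto simp: F_def W_def)

  have "hd A' \<noteq> last A'" "hd B' \<noteq> last B'" using colours white_neq_black by auto
  note cover = covered_by_wb_edges[OF _ _ _ this(1)] covered_by_wb_edges[OF _ _ _ this(2)]
  have coverA: "\<exists>e \<in> E. x \<in> set (R e) \<and> set (R e) \<subseteq> set A'" if "x \<in> set A'" for x
    using cover(1)[of x] spath_infixD[of s A' "a @ B"] that ends sp A by simp
  have coverB: "\<exists>e \<in> E. x \<in> set (R e) \<and> set (R e) \<subseteq> set B'" if "x \<in> set B'" for x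
    using cover(2)[of x] spath_infixD[of "A @ b" B' s'] that ends sp B by simp
  have D_R: "set (D e) \<subseteq> set (R e)" if "e \<in> E" for e
    using R_eq[of "fst e" "snd e"] E_arc[OF that] by (simp add: subset_insertI2)
  have inF: "e \<in> F" if "e \<in> E" "set (R e) \<subseteq> set A' \<or> set (R e) \<subseteq> set B'" for e
    using D_R[OF that(1)] T_subset[of _ e] that A B unfolding F_def whole_def by auto
  \<comment> \<open>\<open>hd A'\<close> is white and lies on a fully traversed edge, of which it
    can only be the white end; likewise \<open>hd B'\<close>.\<close>
  have fst_F: "\<exists>e \<in> F. fst e = hd A'" "\<exists>e \<in> F. fst e = hd B'"
    using coverA[of "hd A'"] coverB[of "hd B'"] inF white_endpoint ends colours ne
    by (metis hd_in_set)+

  have classify: "e \<in> F \<or> x \<in> set s \<and> e = e0 \<or> e = ek \<or> x \<in> set s' \<and> e = e2"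
    if x_in: "x \<in> set A \<union> set B" and e: "e \<in> E" and xT: "x \<in> T Q e" for x e Q
  proof -
    have x: "x \<notin> pverts G" "x \<in> set (D e)" using T_not_vert[OF e xT] T_subset[of Q e] xT by blast+
    consider "x \<in> set s" | "x \<in> set A'" | "x \<in> set (a @ b)" | "x \<in> set B'" | "x \<in> set s'"
      using x_in unfolding A B set_append by blast
    then show ?thesis
    proof cases
      case 1
      then have ne: "s \<noteq> []" by auto
      have "x \<in> set (D e0)" using 1 set_mono_prefix[OF e0(3)[OF ne]] by auto
      then show ?thesis using E_disjoint e0(1)[OF ne] x e 1 by blast
    next
      case 2
      then obtain e' where e': "e' \<in> E" "x \<in> set (R e')" "set (R e') \<subseteq> set A'"
        using coverA by blast
      then have "e' = e" using in_D E_arc E_disjoint x e by blast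
      then show ?thesis using inF e' by blast
    next
      case 3
      then have "x \<in> set (D ek)" using ek by auto
      then show ?thesis using E_disjoint ek(1) x e by blast
    next
      case 4
      then obtain e' where e': "e' \<in> E" "x \<in> set (R e')" "set (R e') \<subseteq> set B'"
        using coverB by blast
      then have "e' = e" using in_D E_arc E_disjoint x e by blast
      then show ?thesis using inF e' by blast
    next
      case 5
      then have ne: "s' \<noteq> []" by auto
      have "x \<in> set (D e2)" using 5 set_mono_suffix[OF e2(2)[OF ne]] by auto
      then show ?thesis using E_disjoint e2(1)[OF ne] x e 5 by blast
    qed
  qed

  \<comment> \<open>A partial edge that is met beyond the third nearest to its entry has that third
    complete in one half.\<close>
  have wX: "whole X e0" if "x \<in> set s" "x \<in> T Q e0" "Q \<noteq> X" for x Q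
    using prefix_covers_X[OF e0(1) e0(3), of x Q] that A by (fastforce simp: whole_def)
  have wZ: "whole Z e2" if "x \<in> set s'" "x \<in> T Q e2" "Q \<noteq> Z" for x Q
    using suffix_covers_Z[OF e2(1) e2(2), of x Q] that B by (fastforce simp: whole_def)
  have wk: "whole X ek \<or> whole Y ek"
    using cut_spares_X_or_Y[OF ek(3)] A B by (auto simp: whole_def)

  have W: "finite (l' ` W)" "l' ` W \<noteq> {}"
    using finite_E fst_F(1) \<open>F \<subseteq> W\<close> by (simp add: W_def, blast)
  obtain q where q: "q \<in> W" "l' q = Max (l' ` W)" using Max_in[OF W] by auto
  then have q_max: "l' e \<le> l' q" if "e \<in> W" for e
    using Max_ge[OF W(1), of "l' e"] that by simp
  have "q \<in> E" using q(1) by (simp add: W_def)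

  \<comment> \<open>\<open>larger_edge_opposite\<close> applies with the halves in either order. The
    edge it yields exceeds the maximum over \<open>W\<close>, so none of its thirds is whole; this
    leaves \<open>e0\<close> and \<open>e2\<close>, which by \<open>wX\<close> and \<open>wZ\<close>
    can be met only in \<open>X\<close> and in \<open>Z\<close> respectively.\<close>
  have step: "Q = X \<and> s \<noteq> [] \<and> l' q < l' e0 \<and> \<not> whole X e0
      \<or> Q = Z \<and> s' \<noteq> [] \<and> l' q < l' e2 \<and> \<not> whole Z e2" if wh: "whole Q q" for Q
  proof -
    have "\<exists>e \<in> E. l' q < l' e \<and> T Q e \<inter> (set A \<union> set B) \<noteq> {}"
    proof (cases "T Q q \<subseteq> set A")
      case True
      then show ?thesis using larger_edge_opposite[OF dist S eq \<open>q \<in> E\<close>] by blast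
    next
      case False
      then have "T Q q \<subseteq> set B" using wh by (simp add: whole_def)
      moreover have "distinct (B @ A)" "set (B @ A) \<subseteq> pverts S" using dist S by auto
      ultimately show ?thesis using larger_edge_opposite[OF _ _ eq[symmetric] \<open>q \<in> E\<close>] by blast
    qed
    then obtain e x where e: "e \<in> E" "l' q < l' e" "x \<in> T Q e" "x \<in> set A \<union> set B" by blast
    have "e \<notin> W" using e(2) q_max[of e] by auto
    then have nw: "\<not> whole Q' e" for Q' using e(1) by (auto simp: W_def)
    then have "e \<notin> F" "e \<noteq> ek" using wk by (auto simp: F_def)
    then consider "x \<in> set s" "e = e0" | "x \<in> set s'" "e = e2"
      using classify[OF e(4,1,3)] by blast
    then show ?thesis
    proof cases
      case 1
      then show ?thesis using wX[of x Q] nw e by auto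
    next
      case 2
      then show ?thesis using wZ[of x Q] nw e by auto
    qed
  qed

  obtain Q where Q: "whole Q q" using q(1) by (auto simp: W_def)
  have "\<not> whole Y q" using step[of Y] by auto
  then have "q \<notin> F" by (auto simp: F_def)
  obtain x where x: "x \<in> T Q q" using T_nonempty[OF \<open>q \<in> E\<close>, of Q] by (meson ex_in_conv)
  then have x_in: "x \<in> set A \<union> set B" using Q unfolding whole_def by blast
  then consider "x \<in> set s" "q = e0" | "q = ek" | "x \<in> set s'" "q = e2"
    using classify[OF x_in \<open>q \<in> E\<close> x] \<open>q \<notin> F\<close> by blast
  then show False
  proof cases
    case 1
    then have "whole X q" using wX[of x Q] x Q by (cases "Q = X") auto
    then show False using step[of X] 1 by auto
  next
    case 2
    then have "whole X q" using wk \<open>\<not> whole Y q\<close> by auto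
    then have lt: "l' ek < l' e0" and "s \<noteq> []" using step[of X] 2 by auto
    note e0 = e0(1,2)[OF \<open>s \<noteq> []\<close>]
    \<comment> \<open>\<open>d\<close> shares its white end \<open>hd A'\<close> with
      \<open>e0\<close>, and \<open>d'\<close> shares \<open>hd B'\<close> with \<open>ek\<close>.
      As \<open>d\<close> is at most \<open>ek\<close> and \<open>d'\<close> is below
      \<open>e0\<close>, the lexicographic order gives both inequalities between the labels of these
      two vertices, which lie in different halves.\<close>
    obtain d d' where d: "d \<in> F" "fst d = hd A'" "d' \<in> F" "fst d' = hd B'" using fst_F by blast
    then have dW: "d \<in> W" "d' \<in> W" using \<open>F \<subseteq> W\<close> by blast+
    then have "l' d \<le> l' ek" "l' d' < l' e0" "d \<in> E" "d' \<in> E"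
      using q_max[OF dW(1)] q_max[OF dW(2)] 2 lt by (simp_all add: W_def)
    then have "\<not> l (hd B') < l (hd A')" "\<not> l (hd A') < l (hd B')"
      using l'_less_iff[of d ek] l'_less_iff[of d' e0] ek(1,2) e0 d by simp_all
    then have "l (hd A') = l (hd B')" by simp
    then have "hd A' = hd B'" using inj_l ends by (auto simp: inj_on_def)
    then show False using dist A B ne by (metis Un_iff disjoint_iff distinct_append hd_in_set set_append)
  next
    case 3
    then have "whole Z q" using wZ[of x Q] x Q by (cases "Q = Z") auto
    then show False using step[of Z] 3 by auto
  qed
qed

text \<open>By alternation both halves start with the same colour and end with the other one;
  reversing the path if necessary makes the first colour white.\<close>

lemma no_anagram_halves:
  assumes sp: "spath (A @ B)" and S: "set (A @ B) \<subseteq> pverts S"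
    and eq: "mset (map c A) = mset (map c B)" and orig: "set (A @ B) \<inter> pverts G \<noteq> {}"
  shows False
proof -
  let ?o = "filter (\<lambda>v. v \<in> pverts G)" and ?w = "map (\<lambda>v. f v = white)"
  \<comment> \<open>White and black occur on original vertices only, so the pattern of the original
    vertices can be read off the colour sequence, and halves with equal colour multisets have equal
    pattern multisets.\<close>
  have w: "?w (?o p) = map (\<lambda>k. k = white) (filter (\<lambda>k. k \<in> {white, black}) (map c p))"
    if "set p \<subseteq> pverts S" for p
    using that
  proof (induction p)
    case (Cons v p)
    then have IH: "?w (?o p) = map (\<lambda>k. k = white) (filter (\<lambda>k. k \<in> {white, black}) (map c p))"
      and v: "v \<in> pverts S" by simp_all
    show ?case
    proof (cases "v \<in> pverts G")
      case True
      then have "c v \<in> {white, black}" "c v = f v"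
        using originals_coloured colour[OF True] by simp_all
      then show ?thesis using True IH by simp
    next
      case False
      then have "c v \<notin> {white, black}" using only_originals[OF v] by blast
      then show ?thesis using False IH by simp
    qed
  qed simp
  have meq: "mset (?w (?o A)) = mset (?w (?o B))"
    using S eq by (simp add: w mset_filter del: mset_map filter_map) (simp add: mset_filter)
  have "successively (\<lambda>u v. (u, v) \<in> parcs G) (?o A @ ?o B)"
    using originals_adjacent[OF sp] by simp
  moreover have "(f u = white) \<noteq> (f v = white)" if "(u, v) \<in> parcs G" for u v
    using proper[OF that] colour arc_verts[OF that] by metis
  ultimately have alt: "successively (\<noteq>) (?w (?o A) @ ?w (?o B))"
    unfolding map_append[symmetric] successively_map by (auto elim!: successively_mono)
  have "?o A \<noteq> [] \<or> ?o B \<noteq> []" using orig by (auto simp: filter_empty_conv)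
  moreover have "length (?o A) = length (?o B)" using meq by (metis size_mset length_map)
  ultimately have neA: "?o A \<noteq> []" and neB: "?o B \<noteq> []" by auto
  obtain s A' a where A: "A = s @ A' @ a" "A' \<noteq> []" "hd A' = hd (?o A)" "last A' = last (?o A)"
      "\<forall>x \<in> set s. x \<notin> pverts G" "\<forall>x \<in> set a. x \<notin> pverts G"
    using trim_outside[OF neA] by blast
  obtain b B' s' where B: "B = b @ B' @ s'" "B' \<noteq> []" "hd B' = hd (?o B)" "last B' = last (?o B)"
      "\<forall>x \<in> set b. x \<notin> pverts G" "\<forall>x \<in> set s'. x \<notin> pverts G"
    using trim_outside[OF neB] by blast
  have ends: "hd A' \<in> pverts G" "last A' \<in> pverts G" "hd B' \<in> pverts G" "last B' \<in> pverts G"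
    using A B hd_in_set[OF neA] last_in_set[OF neA] hd_in_set[OF neB] last_in_set[OF neB] by auto
  have c: "(f (last A') = white) \<noteq> (f (hd A') = white)"
      "(f (last B') = white) \<noteq> (f (hd B') = white)" "(f (hd B') = white) = (f (hd A') = white)"
    using alternating_halves[OF alt meq] neA neB A B by (simp_all add: hd_map last_map)
  show False
  proof (cases "f (hd A') = white")
    case True
    then have "f (last A') = black" "f (hd B') = white" "f (last B') = black"
      using c colour ends by auto
    then show False
      using no_anagram_from_white[OF A(1) B(1) A(2) B(2) sp S eq ends] True A B by blast
  next
    case False
    then have col: "f (hd A') = black" "f (last A') = white" "f (hd B') = black" "f (last B') = white"
      using c colour ends by auto
    \<comment> \<open>Reversal exchanges the halves: \<open>rev B\<close> comes first, and the
      original vertices of both now start with white.\<close>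
    have "rev B = rev s' @ rev B' @ rev b" "rev A = rev a @ rev A' @ rev s"
      "rev B' \<noteq> []" "rev A' \<noteq> []" "spath (rev B @ rev A)" "set (rev B @ rev A) \<subseteq> pverts S"
      using A B spath_rev[OF sp] S by auto
    moreover have "mset (map c (rev B)) = mset (map c (rev A))" using eq by simp
    moreover have "hd (rev B') \<in> pverts G" "last (rev B') \<in> pverts G"
      "hd (rev A') \<in> pverts G" "last (rev A') \<in> pverts G"
      "f (hd (rev B')) = white" "f (last (rev B')) = black"
      "f (hd (rev A')) = white" "f (last (rev A')) = black"
      using ends col by (simp_all add: hd_rev last_rev)
    moreover have "\<forall>x \<in> set (rev s') \<union> set (rev b) \<union> set (rev a) \<union> set (rev s). x \<notin> pverts G"
      using A B by auto
    ultimately show False by (rule no_anagram_from_white)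
  qed
qed

end

theorem theorem15:
  fixes G S :: "'a pair_pre_digraph" and t :: "nat \<Rightarrow> nat"
    and white black :: 'c and f c :: "'a \<Rightarrow> 'c"
    and l :: "'a \<Rightarrow> nat" and l' :: "'a \<times> 'a \<Rightarrow> nat" and R :: "'a \<times> 'a \<Rightarrow> 'a list"
  assumes "pair_graph G"
    and "\<And>i. i \<ge> 1 \<Longrightarrow> t i > 0"
    and "sequence_subdivision t G white black f l l' S R"
    and "discriminating t G white black f l' S R c"
  shows "anagram_free S c"
proof -
  note disc = assms(4)[unfolded discriminating_def]
  obtain C :: "third \<Rightarrow> 'c set" where C: "\<forall>Q. C Q \<noteq> {} \<and>
        (\<forall>v \<in> pverts S. c v \<in> C Q \<longrightarrow>
           (\<exists>e \<in> wb_edges G white black f. v \<in> set (third_path t l' R Q e))) \<and>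
        (\<forall>q \<in> wb_edges G white black f.
           (\<Sum>e \<in> {e \<in> wb_edges G white black f. l' e < l' q}.
              card {v \<in> set (third_path t l' R Q e). c v \<in> C Q})
           < card {v \<in> set (third_path t l' R Q q). c v \<in> C Q})"
    using disc by (elim conjE exE)
  interpret discriminating_subdivision G S R t white black f c l l' C
  proof (intro discriminating_subdivision.intro subdivided_graph.intro
      discriminating_subdivision_axioms.intro)
    show "pair_graph G" "sequence_subdivision t G white black f l l' S R" by fact+
    show "subdivision_via G S R" using assms(3) by (simp add: sequence_subdivision_def)
    show "c v = f v" if "v \<in> pverts G" for v using disc that by blast
    show "v \<in> pverts G" if "v \<in> pverts S" "c v \<in> {white, black}" for v
      using disc[THEN conjunct2, THEN conjunct1] that by blast
  qed (use C in blast)+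
  show ?thesis
    unfolding anagram_free_def
  proof (intro allI impI notI)
    fix p assume p: "vpath p (with_proj S)" and ana: "anagram (map c p)"
    then obtain W P where WP: "map c p = W @ P" "mset W = mset P" by (auto simp: anagram_def)
    then obtain A B where AB: "p = A @ B" "W = map c A" "P = map c B"
      by (auto simp: map_eq_append_conv)
    have "set p \<inter> pverts G \<noteq> {}" using disc p ana by blast
    moreover have "set p \<subseteq> pverts S" using p by (auto simp: vpath_def vwalk_def)
    ultimately show False
      using no_anagram_halves[of A B] spath_if_vpath[OF p] WP AB by simp
  qed
qed

end
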